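(* Let Assumptions 1 and 2 hold, let $\alpha\in(0,1)$, $b\in\mathcal B$, and let $\rho$ be any number in $(0,1)$. If there is $v\in\mathcal V_u$ such that $$\mathbb E\big[\mathbb E_n[(2Y-1)1\{Xb\ge0,Xv<0\}]\mid\mathcal X_n\big]\le-\frac1{\sqrt n}\left(q_{1-\alpha}\max\left\{\epsilon,\sqrt{\frac{\mathbb E_n[1\{Xb\ge0,Xv<0\}]}{1+q_{1-\alpha}^2/n}}\right\}+\sqrt{2\log(1/\rho)\,\mathbb E_n[1\{Xb\ge0,Xv<0\}]}\right),$$ or there is $v\in\mathcal V_l$ such that $$\mathbb E\big[\mathbb E_n[(1-2Y)1\{Xb\le0,Xv>0\}]\mid\mathcal X_n\big]\le-\frac1{\sqrt n}\left(q_{1-\alpha}\max\left\{\epsilon,\sqrt{\frac{\mathbb E_n[1\{Xb\le0,Xv>0\}]}{1+q_{1-\alpha}^2/n}}\right\}+\sqrt{2\log(1/\rho)\,\mathbb E_n[1\{Xb\le0,Xv>0\}]}\right),$$ then the rejection probability is at least $1-\rho$, i.e. $\mathbb P(T_n(b)>q_{1-\alpha}\mid\mathcal X_n)\ge1-\rho$.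
   Context: Setting. $n,K\ge 1$ are integers; $Y_i\in\{0,1\}$, $X_i$ is a row vector in $\mathbb{R}^K$, $U_i$ is real valued, $i=1,\dots,n$; $\mathcal{X}_n\equiv(X_1,\dots,X_n)$. The analysis is conditional on $\mathcal{X}_n$ (it may be read for a fixed realization of $\mathcal{X}_n$). For any expression in $(Y,X)$, $\mathbb{E}_n[\cdot]\equiv n^{-1}\sum_{i=1}^n[\cdot]$, where $(Y,X)$ is evaluated at $(Y_i,X_i)$ in the $i$th summand. Assumption 1. (i) The random vectors $(Y_i,X_i,U_i)$, $i=1,\dots,n$, are defined on a probability space $(\Omega,\mathfrak F,\mathbb P)$, where $\mathfrak F$ contains the Borel sets on $\Omega$. (ii) $(Y_i,X_i)$, $i=1,\dots,n$, are observed. (iii) There is a column vector $\beta\in\mathbb{R}^K$ such that $\mathbb P(Y_i=1\{X_i\beta+U_i\ge 0\}\mid\mathcal X_n)=1$ and $\mathbb P(U_i\ge 0\mid\mathcal X_n)=1/2$ for every $i$. (iv) $\beta$ belongs to a known set $\mathcal B\subseteq\mathbb R^K$. (v) $1\{U_1\ge0\},\dots,1\{U_n\ge0\}$ are mutually independent conditional on $\mathcal X_n$. Assumption 2. $U_1,\dots,U_n$ are mutually independent conditional on $\mathcal X_n$. Test statistic. $\mathcal V_u,\mathcal V_l\subseteq\mathbb R^K$ are (nonempty) index sets and $\epsilon>0$ is a fixed (small) number. Define $\hat m_u(b,v)\equiv\mathbb E_n[(2Y-1)1\{Xb\ge0,Xv<0\}]$, $\hat m_l(b,v)\equiv\mathbb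 E_n[(1-2Y)1\{Xb\le0,Xv>0\}]$, $\hat\sigma_u^2(b,v)\equiv\mathbb E_n[1\{Xb\ge0,Xv<0\}]-\hat m_u(b,v)^2$, $\hat\sigma_l^2(b,v)\equiv\mathbb E_n[1\{Xb\le0,Xv>0\}]-\hat m_l(b,v)^2$, $\hat T_c(b,\mathcal V)\equiv\sup_{v\in\mathcal V}\sqrt n\,\frac{-\hat m_c(b,v)}{\max\{\hat\sigma_c(b,v),\epsilon\}}$ for $c\in\{u,l\}$, and $T_n(b)\equiv\max\{0,\hat T_u(b,\mathcal V_u),\hat T_l(b,\mathcal V_l)\}$. Critical value. Let $Y_i^*\equiv1\{U_i\ge0\}$ and let $T_n^*(b)$ be defined exactly as $T_n(b)$ but with $Y_i$ replaced by $Y_i^*$ for all $i$ (in the $\hat m$'s and hence in the $\hat\sigma$'s). Given $\mathcal X_n$, the variables $2Y_i^*-1$ are independent Rademacher variables, so the conditional law of $T_n^*(b)$ is known. Define $q_{1-\alpha}\equiv\inf\{c\in\mathbb R:\mathbb P(T_n^*(b)\le c\mid\mathcal X_n)\ge1-\alpha\}$.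
   Formalization: The violating v is also required to have E_n[1{Xb≥0,Xv<0}]>0 (resp. E_n[1{Xb≤0,Xv>0}]>0); without this the claim fails, e.g. if all X_i=0, where T_n=q=0 and the condition holds as 0≤0 but the test never rejects. *)

theory Defs
  imports "HOL-Probability.Probability"
begin

text \<open>
  Everything is conditional on the covariates: \<open>X\<close> is a fixed realization of the sample of
  covariates, indexed by \<open>{1..n}\<close>, and the probability measure \<open>M\<close> is the conditional law of
  the remaining randomness. A row vector times a column vector is an inner product.
\<close>

locale binary_choice = prob_space M
  for M :: "'a measure" +
  fixes n :: nat
    and X :: "nat \<Rightarrow> real ^ 'k"
    and Y U :: "nat \<Rightarrow> 'a \<Rightarrow> real"
    and B :: "(real ^ 'k) set"
  assumes n_pos: "n \<ge> 1"
    and Y_measurable: "\<And>i. i \<in> {1..n} \<Longrightarrow> Y i \<in> borel_measurable M"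
    and U_measurable: "\<And>i. i \<in> {1..n} \<Longrightarrow> U i \<in> borel_measurable M"
    and Y_binary: "\<And>i \<omega>. i \<in> {1..n} \<Longrightarrow> \<omega> \<in> space M \<Longrightarrow> Y i \<omega> \<in> {0, 1}"
    and model: "\<exists>\<beta>\<in>B. \<forall>i\<in>{1..n}. \<P>(\<omega> in M. Y i \<omega> = of_bool (X i \<bullet> \<beta> + U i \<omega> \<ge> 0)) = 1"
    and median_zero: "\<And>i. i \<in> {1..n} \<Longrightarrow> \<P>(\<omega> in M. U i \<omega> \<ge> 0) = 1 / 2"
    and signs_indep: "indep_vars (\<lambda>_. borel) (\<lambda>i \<omega>. of_bool (U i \<omega> \<ge> 0) :: real) {1..n}"

definition En :: "nat \<Rightarrow> (nat \<Rightarrow> real) \<Rightarrow> real" where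
  "En n f = (\<Sum>i = 1..n. f i) / real n"

text \<open>
  In the following, \<open>y :: nat \<Rightarrow> real\<close> is the vector of outcomes; it is instantiated
  both with a realization of \<open>Y\<close> and with the signs \<open>1{U \<ge> 0}\<close>.
\<close>

definition ind_u :: "(nat \<Rightarrow> real ^ 'k) \<Rightarrow> real ^ 'k \<Rightarrow> real ^ 'k \<Rightarrow> nat \<Rightarrow> real" where
  "ind_u X b v i = of_bool (X i \<bullet> b \<ge> 0 \<and> X i \<bullet> v < 0)"

definition ind_l :: "(nat \<Rightarrow> real ^ 'k) \<Rightarrow> real ^ 'k \<Rightarrow> real ^ 'k \<Rightarrow> nat \<Rightarrow> real" where
  "ind_l X b v i = of_bool (X i \<bullet> b \<le> 0 \<and> X i \<bullet> v > 0)"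

definition m_u :: "nat \<Rightarrow> (nat \<Rightarrow> real ^ 'k) \<Rightarrow> (nat \<Rightarrow> real) \<Rightarrow> real ^ 'k \<Rightarrow> real ^ 'k \<Rightarrow> real" where
  "m_u n X y b v = En n (\<lambda>i. (2 * y i - 1) * ind_u X b v i)"

definition m_l :: "nat \<Rightarrow> (nat \<Rightarrow> real ^ 'k) \<Rightarrow> (nat \<Rightarrow> real) \<Rightarrow> real ^ 'k \<Rightarrow> real ^ 'k \<Rightarrow> real" where
  "m_l n X y b v = En n (\<lambda>i. (1 - 2 * y i) * ind_l X b v i)"

definition sigma_u :: "nat \<Rightarrow> (nat \<Rightarrow> real ^ 'k) \<Rightarrow> (nat \<Rightarrow> real) \<Rightarrow> real ^ 'k \<Rightarrow> real ^ 'k \<Rightarrow> real" where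
  "sigma_u n X y b v = sqrt (En n (ind_u X b v) - (m_u n X y b v)\<^sup>2)"

definition sigma_l :: "nat \<Rightarrow> (nat \<Rightarrow> real ^ 'k) \<Rightarrow> (nat \<Rightarrow> real) \<Rightarrow> real ^ 'k \<Rightarrow> real ^ 'k \<Rightarrow> real" where
  "sigma_l n X y b v = sqrt (En n (ind_l X b v) - (m_l n X y b v)\<^sup>2)"

text \<open>
  For nonempty \<open>V\<close> and \<open>\<epsilon> > 0\<close> the suprema below are genuine real suprema: since \<open>v\<close> enters
  only through \<open>n\<close> indicators, only finitely many values are attained.
\<close>

definition T_u :: "nat \<Rightarrow> (nat \<Rightarrow> real ^ 'k) \<Rightarrow> real \<Rightarrow> (nat \<Rightarrow> real) \<Rightarrow> real ^ 'k \<Rightarrow> (real ^ 'k) set \<Rightarrow> real" where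
  "T_u n X \<epsilon> y b V = (SUP v\<in>V. sqrt (real n) * (- m_u n X y b v / max (sigma_u n X y b v) \<epsilon>))"

definition T_l :: "nat \<Rightarrow> (nat \<Rightarrow> real ^ 'k) \<Rightarrow> real \<Rightarrow> (nat \<Rightarrow> real) \<Rightarrow> real ^ 'k \<Rightarrow> (real ^ 'k) set \<Rightarrow> real" where
  "T_l n X \<epsilon> y b V = (SUP v\<in>V. sqrt (real n) * (- m_l n X y b v / max (sigma_l n X y b v) \<epsilon>))"

definition test_stat ::
  "nat \<Rightarrow> (nat \<Rightarrow> real ^ 'k) \<Rightarrow> (real ^ 'k) set \<Rightarrow> (real ^ 'k) set \<Rightarrow> real \<Rightarrow> (nat \<Rightarrow> real) \<Rightarrow> real ^ 'k \<Rightarrow> real" where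
  "test_stat n X Vu Vl \<epsilon> y b = Max {0, T_u n X \<epsilon> y b Vu, T_l n X \<epsilon> y b Vl}"

definition crit_val ::
  "'a measure \<Rightarrow> nat \<Rightarrow> (nat \<Rightarrow> real ^ 'k) \<Rightarrow> (nat \<Rightarrow> 'a \<Rightarrow> real) \<Rightarrow> (real ^ 'k) set \<Rightarrow> (real ^ 'k) set
    \<Rightarrow> real \<Rightarrow> real \<Rightarrow> real ^ 'k \<Rightarrow> real" where
  "crit_val M n X U Vu Vl \<epsilon> \<alpha> b =
    Inf {c. \<P>(\<omega> in M. test_stat n X Vu Vl \<epsilon> (\<lambda>i. of_bool (U i \<omega> \<ge> 0)) b \<le> c) \<ge> 1 - \<alpha>}"

end

theory Submission
  imports Defs "HOL-Probability.Hoeffding"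
begin

text \<open>
  Off an event of probability at most \<open>\<rho>\<close>, Hoeffding's inequality keeps the moment at the violating
  \<open>v\<close> within \<open>\<surd>(2 ln (1/\<rho>) p / n)\<close> of its mean, where \<open>p\<close> is the mean of the
  indicators. Then \<open>s = - \<surd>n m\<close> exceeds \<open>q max {\<epsilon>, \<surd>(p / (1 + q\<^sup>2/n))}\<close>.
  Since the estimated variance is \<open>p - s\<^sup>2/n\<close>, the bound \<open>s\<^sup>2 > q\<^sup>2 p / (1 + q\<^sup>2/n)\<close>
  is the same as \<open>s\<^sup>2 > q\<^sup>2 (p - s\<^sup>2/n)\<close>, so the studentized moment exceeds \<open>q\<close>.
\<close>

text \<open>A common form for both moments: the upper one has weights \<open>ind_u\<close>, the
  lower one \<open>- ind_l\<close>, which absorbs the reversed sign \<open>1 - 2 * y i\<close>. One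
  concentration argument then covers both sides of the test.\<close>

definition signed_mean :: "nat \<Rightarrow> (nat \<Rightarrow> real) \<Rightarrow> (nat \<Rightarrow> real) \<Rightarrow> real" where
  "signed_mean n y w = En n (\<lambda>i. (2 * y i - 1) * w i)"

lemma m_u_eq_signed_mean: "m_u n X y b v = signed_mean n y (ind_u X b v)"
  by (simp add: m_u_def signed_mean_def)

lemma m_l_eq_signed_mean: "m_l n X y b v = signed_mean n y (\<lambda>i. - ind_l X b v i)"
  by (simp add: m_l_def signed_mean_def algebra_simps)

lemma signed_mean_cong:
  assumes "\<And>i. i \<in> {1..n} \<Longrightarrow> y i = y' i"
  shows "signed_mean n y w = signed_mean n y' w"
  using assms by (simp add: signed_mean_def En_def)

section \<open>Uniform bounds on the studentized moments and the test statistic\<close>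

lemma abs_signed_mean_le_1:
  assumes n: "n \<ge> 1"
    and y: "\<And>i. i \<in> {1..n} \<Longrightarrow> y i \<in> {0, 1}"
    and w: "\<And>i. \<bar>w i\<bar> \<le> 1"
  shows "\<bar>signed_mean n y w\<bar> \<le> 1"
proof -
  have "\<bar>(2 * y i - 1) * w i\<bar> \<le> 1" if "i \<in> {1..n}" for i
    using y[OF that] w[of i] by auto
  then have "\<bar>\<Sum>i = 1..n. (2 * y i - 1) * w i\<bar> \<le> (\<Sum>i = 1..n. 1)"
    by (intro order_trans[OF sum_abs] sum_mono) auto
  then show ?thesis
    using n by (simp add: signed_mean_def En_def)
qed

text \<open>The floor \<open>\<epsilon>\<close> keeps the denominator away from zero whatever
  \<open>s\<close> is, so the bound is uniform over the index \<open>v\<close>. This uniformity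
  supplies the boundedness under which the real suprema are meaningful.\<close>

lemma studentized_le:
  fixes m s \<epsilon> :: real
  assumes "\<epsilon> > 0" "\<bar>m\<bar> \<le> 1"
  shows "sqrt (real n) * (- m / max s \<epsilon>) \<le> sqrt (real n) / \<epsilon>"
proof -
  have "- m / max s \<epsilon> \<le> 1 / \<epsilon>"
    using assms by (intro frac_le) auto
  from mult_left_mono[OF this, of "sqrt (real n)"] show ?thesis by simp
qed

lemma
  assumes "n \<ge> 1" "\<epsilon> > 0" "\<And>i. i \<in> {1..n} \<Longrightarrow> y i \<in> {0, 1}"
  shows studentized_u_le:
      "sqrt (real n) * (- m_u n X y b v / max (sigma_u n X y b v) \<epsilon>) \<le> sqrt (real n) / \<epsilon>"
    and studentized_l_le:
      "sqrt (real n) * (- m_l n X y b v / max (sigma_l n X y b v) \<epsilon>) \<le> sqrt (real n) / \<epsilon>"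
proof -
  have "\<bar>m_u n X y b v\<bar> \<le> 1" "\<bar>m_l n X y b v\<bar> \<le> 1"
    unfolding m_u_eq_signed_mean m_l_eq_signed_mean
    by (intro abs_signed_mean_le_1 assms(1,3); simp add: ind_u_def ind_l_def)+
  then show
      "sqrt (real n) * (- m_u n X y b v / max (sigma_u n X y b v) \<epsilon>) \<le> sqrt (real n) / \<epsilon>"
      "sqrt (real n) * (- m_l n X y b v / max (sigma_l n X y b v) \<epsilon>) \<le> sqrt (real n) / \<epsilon>"
    using assms(2) by (blast intro: studentized_le)+
qed

text \<open>A deterministic ceiling, which later witnesses that the set defining the critical value
  is nonempty. The index sets must be nonempty because the supremum of an empty set of reals is
  unspecified.\<close>

lemma test_stat_le:
  assumes "n \<ge> 1" "\<epsilon> > 0" "\<And>i. i \<in> {1..n} \<Longrightarrow> y i \<in> {0, 1}" "Vu \<noteq> {}" "Vl \<noteq> {}"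
  shows "test_stat n X Vu Vl \<epsilon> y b \<le> sqrt (real n) / \<epsilon>"
proof -
  have "T_u n X \<epsilon> y b Vu \<le> sqrt (real n) / \<epsilon>" "T_l n X \<epsilon> y b Vl \<le> sqrt (real n) / \<epsilon>"
    unfolding T_u_def T_l_def
    by (intro cSUP_least studentized_u_le studentized_l_le assms; assumption)+
  then show ?thesis
    using assms(2) by (simp add: test_stat_def)
qed

lemma test_stat_nonneg: "0 \<le> test_stat n X Vu Vl \<epsilon> y b"
  by (simp add: test_stat_def)

text \<open>Reduces rejection to a single index: it suffices that the ratio at the violating
  \<open>v\<close> exceeds the critical value.\<close>

lemma studentized_u_le_test_stat:
  assumes "n \<ge> 1" "\<epsilon> > 0" "\<And>i. i \<in> {1..n} \<Longrightarrow> y i \<in> {0, 1}" "v \<in> Vu"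
  shows "sqrt (real n) * (- m_u n X y b v / max (sigma_u n X y b v) \<epsilon>) \<le> test_stat n X Vu Vl \<epsilon> y b"
proof -
  have "sqrt (real n) * (- m_u n X y b v / max (sigma_u n X y b v) \<epsilon>) \<le> T_u n X \<epsilon> y b Vu"
    unfolding T_u_def using assms
    by (intro cSUP_upper bdd_aboveI2[where M = "sqrt (real n) / \<epsilon>"] studentized_u_le) auto
  also have "\<dots> \<le> test_stat n X Vu Vl \<epsilon> y b"
    by (simp add: test_stat_def)
  finally show ?thesis .
qed

lemma studentized_l_le_test_stat:
  assumes "n \<ge> 1" "\<epsilon> > 0" "\<And>i. i \<in> {1..n} \<Longrightarrow> y i \<in> {0, 1}" "v \<in> Vl"
  shows "sqrt (real n) * (- m_l n X y b v / max (sigma_l n X y b v) \<epsilon>) \<le> test_stat n X Vu Vl \<epsilon> y b"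
proof -
  have "sqrt (real n) * (- m_l n X y b v / max (sigma_l n X y b v) \<epsilon>) \<le> T_l n X \<epsilon> y b Vl"
    unfolding T_l_def using assms
    by (intro cSUP_upper bdd_aboveI2[where M = "sqrt (real n) / \<epsilon>"] studentized_l_le) auto
  also have "\<dots> \<le> test_stat n X Vu Vl \<epsilon> y b"
    by (simp add: test_stat_def)
  finally show ?thesis .
qed

text \<open>Makes the statistic a function of finitely many outcomes, the locality condition
  required by \<open>outcome_event\<close>.\<close>

lemma test_stat_cong:
  assumes "\<And>i. i \<in> {1..n} \<Longrightarrow> y i = y' i"
  shows "test_stat n X Vu Vl \<epsilon> y b = test_stat n X Vu Vl \<epsilon> y' b"
proof -
  have eq: "signed_mean n y = signed_mean n y'"
    using signed_mean_cong[of n y y'] assms by blast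
  show ?thesis
    by (simp add: test_stat_def T_u_def T_l_def sigma_u_def sigma_l_def
        m_u_eq_signed_mean m_l_eq_signed_mean eq)
qed

section \<open>Sign of the critical value and inversion of the studentized ratio\<close>

lemma crit_val_nonneg:
  assumes "prob_space M" "n \<ge> 1" "\<epsilon> > 0" "Vu \<noteq> {}" "Vl \<noteq> {}" "0 < \<alpha>" "\<alpha> < 1"
  shows "0 \<le> crit_val M n X U Vu Vl \<epsilon> \<alpha> b"
  unfolding crit_val_def
proof (rule cInf_greatest)
  interpret prob_space M by fact
  let ?T = "\<lambda>\<omega>. test_stat n X Vu Vl \<epsilon> (\<lambda>i. of_bool (U i \<omega> \<ge> 0)) b"
  \<comment> \<open>At the deterministic ceiling the event is the whole space, so this level belongs
    to the set whose infimum is taken.\<close>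
  have "{\<omega> \<in> space M. ?T \<omega> \<le> sqrt (real n) / \<epsilon>} = space M"
    using assms by (auto intro!: test_stat_le)
  then have "\<P>(\<omega> in M. ?T \<omega> \<le> sqrt (real n) / \<epsilon>) = 1"
    by (simp only: prob_space)
  then show "{c. 1 - \<alpha> \<le> \<P>(\<omega> in M. ?T \<omega> \<le> c)} \<noteq> {}"
    using assms(6) by (auto intro!: exI[of _ "sqrt (real n) / \<epsilon>"])
  show "0 \<le> c" if "c \<in> {c. 1 - \<alpha> \<le> \<P>(\<omega> in M. ?T \<omega> \<le> c)}" for c
  \<comment> \<open>The statistic is never negative, so a level below zero has probability zero,
    short of \<open>1 - \<alpha> > 0\<close>.\<close>
  proof (rule ccontr)
    assume "\<not> 0 \<le> c"
    then have empty: "{\<omega> \<in> space M. ?T \<omega> \<le> c} = {}"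
      using order_trans[OF test_stat_nonneg] by blast
    show False
      using that assms(7) unfolding mem_Collect_eq empty by simp
  qed
qed

text \<open>The two arms of the maximum in \<open>large\<close> serve the two arms of the maximum in
  the denominator: the \<open>\<epsilon>\<close> arm handles the floor, the square-root arm handles
  the estimated standard deviation.\<close>

lemma studentized_gt:
  fixes m p q \<epsilon> :: real
  assumes n: "n \<ge> 1" and \<epsilon>: "\<epsilon> > 0" and q: "q \<ge> 0" and p: "p \<ge> 0"
    and large: "- (sqrt (real n) * m) > q * max \<epsilon> (sqrt (p / (1 + q\<^sup>2 / real n)))"
  shows "sqrt (real n) * (- m / max (sqrt (p - m\<^sup>2)) \<epsilon>) > q"
proof -
  define s where "s = - (sqrt (real n) * m)"
  have s2: "s\<^sup>2 = real n * m\<^sup>2"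
    by (simp add: s_def power_mult_distrib)
  have s_gt: "q * \<epsilon> < s" "q * sqrt (p / (1 + q\<^sup>2 / real n)) < s"
    using large q mult_left_mono[OF max.cobounded1 q] mult_left_mono[OF max.cobounded2 q]
    unfolding s_def by (blast intro: le_less_trans)+
  have d: "1 + q\<^sup>2 / real n > 0"
    by (intro add_pos_nonneg) auto
  have "(q * sqrt (p / (1 + q\<^sup>2 / real n)))\<^sup>2 < s\<^sup>2"
    using s_gt(2) q p d by (intro power_strict_mono) auto
  then have "q\<^sup>2 * p / (1 + q\<^sup>2 / real n) < s\<^sup>2"
    using p d by (simp add: power_mult_distrib)
  then have "q\<^sup>2 * p < s\<^sup>2 * (1 + q\<^sup>2 / real n)"
    using d by (simp add: pos_divide_less_eq)
  then have *: "q\<^sup>2 * (p - m\<^sup>2) < s\<^sup>2"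
    using n by (simp add: s2 algebra_simps)
  have "0 \<le> q * \<epsilon>" using q \<epsilon> by simp
  then have "s > 0" using s_gt(1) by linarith
  \<comment> \<open>The real \<open>sqrt\<close> is odd and strictly increasing on the whole line,
    so no sign of \<open>p - m\<^sup>2\<close> has to be known.\<close>
  have "sqrt (q\<^sup>2 * (p - m\<^sup>2)) < sqrt (s\<^sup>2)"
    using * by (simp only: real_sqrt_less_iff)
  then have "q * sqrt (p - m\<^sup>2) < s"
    using q \<open>s > 0\<close> by (simp add: real_sqrt_mult)
  then have "q * max (sqrt (p - m\<^sup>2)) \<epsilon> < s"
    using s_gt(1) by (simp add: max_def)
  then have "q < s / max (sqrt (p - m\<^sup>2)) \<epsilon>"
    using \<epsilon> by (simp add: pos_less_divide_eq less_max_iff_disj)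
  then show ?thesis by (simp add: s_def)
qed

section \<open>Measurability, concentration and power under the model\<close>

context binary_choice
begin

text \<open>Binary outcomes have finitely many configurations, each described by the set
  \<open>S\<close> of indices with outcome 1, so the event is a finite union of measurable cells.
  Measurability of rejection thus follows even though the suprema may run over uncountable index
  sets.\<close>

lemma outcome_event:
  assumes "\<And>y y'. (\<And>i. i \<in> {1..n} \<Longrightarrow> y i = y' i) \<Longrightarrow> P y = P y'"
  shows "{\<omega> \<in> space M. P (\<lambda>i. Y i \<omega>)} \<in> events"
proof -
  let ?Q = "{S. S \<subseteq> {1..n} \<and> P (\<lambda>i. of_bool (i \<in> S))}"
  have "{\<omega> \<in> space M. P (\<lambda>i. Y i \<omega>)}
      = (\<Union>S\<in>?Q. {\<omega> \<in> space M. \<forall>i\<in>{1..n}. Y i \<omega> = of_bool (i \<in> S)})" (is "?L = ?R")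
  proof (rule set_eqI)
    fix \<omega>
    show "\<omega> \<in> ?L \<longleftrightarrow> \<omega> \<in> ?R"
    proof
      assume L: "\<omega> \<in> ?L"
      let ?S = "{i \<in> {1..n}. Y i \<omega> = 1}"
      have *: "Y i \<omega> = of_bool (i \<in> ?S)" if "i \<in> {1..n}" for i
        using Y_binary[OF that, of \<omega>] L that by auto
      have "P (\<lambda>i. Y i \<omega>) = P (\<lambda>i. of_bool (i \<in> ?S))"
        using * by (rule assms)
      then show "\<omega> \<in> ?R" using L * by (intro UN_I[of ?S]) auto
    next
      assume "\<omega> \<in> ?R"
      then obtain S where S: "\<omega> \<in> space M" "P (\<lambda>i. of_bool (i \<in> S))"
        "\<forall>i\<in>{1..n}. Y i \<omega> = of_bool (i \<in> S)" by auto
      have "P (\<lambda>i. Y i \<omega>) = P (\<lambda>i. of_bool (i \<in> S))"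
        by (rule assms) (use S in auto)
      then show "\<omega> \<in> ?L" using S by simp
    qed
  qed
  moreover have "finite ?Q" by (rule finite_subset[of _ "Pow {1..n}"]) auto
  moreover have "{\<omega> \<in> space M. \<forall>i\<in>{1..n}. Y i \<omega> = of_bool (i \<in> S)} \<in> events" for S
    using Y_measurable by measurable
  ultimately show ?thesis by (simp only: sets.finite_UN)
qed

lemma AE_model:
  obtains \<beta> where "AE \<omega> in M. \<forall>i\<in>{1..n}. Y i \<omega> = of_bool (X i \<bullet> \<beta> + U i \<omega> \<ge> 0)"
proof -
  from model obtain \<beta> where
    \<beta>: "\<And>i. i \<in> {1..n} \<Longrightarrow> \<P>(\<omega> in M. Y i \<omega> = of_bool (X i \<bullet> \<beta> + U i \<omega> \<ge> 0)) = 1"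
    by blast
  have "AE \<omega> in M. Y i \<omega> = of_bool (X i \<bullet> \<beta> + U i \<omega> \<ge> 0)" if i: "i \<in> {1..n}" for i
  proof -
    have [measurable]: "Y i \<in> borel_measurable M" "U i \<in> borel_measurable M"
      using i Y_measurable U_measurable by auto
    have "{\<omega> \<in> space M. Y i \<omega> = of_bool (X i \<bullet> \<beta> + U i \<omega> \<ge> 0)} \<in> events"
      by measurable
    from prob_Collect_eq_1[OF this] \<beta>[OF i] show ?thesis by simp
  qed
  then show ?thesis
    by (intro that[of \<beta>] AE_finite_allI) simp_all
qed

lemma signed_mean_measurable:
  "(\<lambda>\<omega>. signed_mean n (\<lambda>i. Y i \<omega>) w) \<in> borel_measurable M"
  unfolding signed_mean_def En_def using Y_measurable
  by (intro borel_measurable_divide borel_measurable_sum) auto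

text \<open>Each outcome is almost surely a function of its own \<open>U i\<close>, so independence
  of the errors passes to the summands and Hoeffding's inequality applies to their sum.\<close>

lemma signed_mean_concentration:
  assumes U_indep: "indep_vars (\<lambda>_. borel) U {1..n}"
    and p: "En n (\<lambda>i. (w i)\<^sup>2) > 0" and t: "t \<ge> 0"
  defines "m \<equiv> \<lambda>\<omega>. signed_mean n (\<lambda>i. Y i \<omega>) w"
  shows "prob {\<omega> \<in> space M. m \<omega> < expectation m + t}
    \<ge> 1 - exp (- (real n * t\<^sup>2 / (2 * En n (\<lambda>i. (w i)\<^sup>2))))"
proof -
  obtain \<beta> where \<beta>: "AE \<omega> in M. \<forall>i\<in>{1..n}. Y i \<omega> = of_bool (X i \<bullet> \<beta> + U i \<omega> \<ge> 0)"
    by (rule AE_model)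
  have n: "real n > 0" using n_pos by simp
  \<comment> \<open>Outcomes follow the model only almost surely; \<open>Z\<close> follows it
    everywhere, so it is an exact function of \<open>U i\<close> and inherits independence directly.
    The result returns to \<open>m\<close> through almost-everywhere equality.\<close>
  define Z where "Z = (\<lambda>i \<omega>. (2 * of_bool (X i \<bullet> \<beta> + U i \<omega> \<ge> 0) - 1) * w i)"
  \<comment> \<open>The ranges scale with the weights, so observations of weight zero add no width.
    This is why the exponent involves the mean squared weight.\<close>
  interpret H: Hoeffding_ineq M "{1..n}" Z "\<lambda>i. - \<bar>w i\<bar>" "\<lambda>i. \<bar>w i\<bar>" "\<Sum>i = 1..n. expectation (Z i)"
  proof unfold_locales
    show "indep_vars (\<lambda>_. borel) Z {1..n}"
      unfolding Z_def
      by (rule indep_vars_compose2[OF U_indep,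
            where Y = "\<lambda>i u. (2 * of_bool (X i \<bullet> \<beta> + u \<ge> 0) - 1) * w i"]) simp
    show "AE \<omega> in M. Z i \<omega> \<in> {- \<bar>w i\<bar>..\<bar>w i\<bar>}" for i
      by (auto simp: Z_def)
  qed auto
  have Z_int: "integrable M (Z i)" if "i \<in> {1..n}" for i
    using H.bounded_random_variable[OF that] by (rule interval_bounded_random_variable.integrable)
  have AE_m: "AE \<omega> in M. m \<omega> = (\<Sum>i = 1..n. Z i \<omega>) / real n"
    using \<beta> by eventually_elim (simp add: m_def signed_mean_def En_def Z_def)
  have m_meas [measurable]: "m \<in> borel_measurable M"
    unfolding m_def by (rule signed_mean_measurable)
  have Z_meas: "(\<lambda>\<omega>. \<Sum>i = 1..n. Z i \<omega>) \<in> borel_measurable M"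
    using H.random_variable by (intro borel_measurable_sum)
  have "expectation m = expectation (\<lambda>\<omega>. (\<Sum>i = 1..n. Z i \<omega>) / real n)"
    using AE_m Z_meas by (intro integral_cong_AE) auto
  then have Em: "expectation m = (\<Sum>i = 1..n. expectation (Z i)) / real n"
    using Z_int by (simp add: Bochner_Integration.integral_sum)
  have width: "(\<Sum>i = 1..n. (\<bar>w i\<bar> - - \<bar>w i\<bar>)\<^sup>2) = 4 * real n * En n (\<lambda>i. (w i)\<^sup>2)"
    using n by (simp add: En_def power_mult_distrib flip: sum_distrib_left)
  have "prob {\<omega> \<in> space M. m \<omega> \<ge> expectation m + t}
      = prob {\<omega> \<in> space M. (\<Sum>i = 1..n. Z i \<omega>) \<ge> (\<Sum>i = 1..n. expectation (Z i)) + real n * t}"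
  proof (rule prob_eq_AE)
    show "AE \<omega> in M. (m \<omega> \<ge> expectation m + t)
        = ((\<Sum>i = 1..n. Z i \<omega>) \<ge> (\<Sum>i = 1..n. expectation (Z i)) + real n * t)"
      using AE_m by eventually_elim (use n in \<open>simp add: Em field_simps\<close>)
  qed (use Z_meas in measurable)
  also have "\<dots> \<le> exp (- 2 * (real n * t)\<^sup>2 / (\<Sum>i = 1..n. (\<bar>w i\<bar> - - \<bar>w i\<bar>)\<^sup>2))"
  proof (rule H.Hoeffding_ineq_ge)
    show "real n * t \<ge> 0" using t by simp
    \<comment> \<open>Hoeffding's exponent divides by the total squared width, which is positive
      because of \<open>p\<close>.\<close>
    show "(\<Sum>i = 1..n. (\<bar>w i\<bar> - - \<bar>w i\<bar>)\<^sup>2) > 0" unfolding width using n p by simp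
  qed
  \<comment> \<open>The constants are \<open>2 * (n * t)\<^sup>2\<close> over \<open>4 * n\<close>
    times the mean squared weight.\<close>
  also have "\<dots> = exp (- (real n * t\<^sup>2 / (2 * En n (\<lambda>i. (w i)\<^sup>2))))"
    unfolding width using n p by (simp add: field_simps power2_eq_square)
  finally have "prob {\<omega> \<in> space M. m \<omega> \<ge> expectation m + t}
      \<le> exp (- (real n * t\<^sup>2 / (2 * En n (\<lambda>i. (w i)\<^sup>2))))" .
  moreover have "prob {\<omega> \<in> space M. \<not> (m \<omega> \<ge> expectation m + t)}
      = 1 - prob {\<omega> \<in> space M. m \<omega> \<ge> expectation m + t}"
    by (rule prob_neg) measurable
  ultimately show ?thesis by (simp add: not_le)
qed

text \<open>Treats both sides of the test at once: \<open>lower\<close> hides which supremum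
  contains the studentized moment, and \<open>w\<close> is \<open>ind_u\<close> or
  \<open>- ind_l\<close>.\<close>

lemma prob_test_stat_gt:
  assumes U_indep: "indep_vars (\<lambda>_. borel) U {1..n}"
    and \<epsilon>: "\<epsilon> > 0" and \<rho>: "0 < \<rho>" "\<rho> < 1" and q: "q \<ge> 0"
    and p_def: "p = En n (\<lambda>i. (w i)\<^sup>2)" and p: "p > 0"
    and mean: "expectation (\<lambda>\<omega>. signed_mean n (\<lambda>i. Y i \<omega>) w)
      \<le> - (1 / sqrt (real n)) * (q * max \<epsilon> (sqrt (p / (1 + q\<^sup>2 / real n))) + sqrt (2 * ln (1 / \<rho>) * p))"
    and lower: "\<And>y m. (\<And>i. i \<in> {1..n} \<Longrightarrow> y i \<in> {0, 1}) \<Longrightarrow> m = signed_mean n y w \<Longrightarrow>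
      sqrt (real n) * (- m / max (sqrt (p - m\<^sup>2)) \<epsilon>) \<le> test_stat n X Vu Vl \<epsilon> y b"
  shows "\<P>(\<omega> in M. test_stat n X Vu Vl \<epsilon> (\<lambda>i. Y i \<omega>) b > q) \<ge> 1 - \<rho>"
proof -
  have n: "real n > 0" using n_pos by simp
  define m where "m = (\<lambda>\<omega>. signed_mean n (\<lambda>i. Y i \<omega>) w)"
  define c where "c = q * max \<epsilon> (sqrt (p / (1 + q\<^sup>2 / real n)))"
  \<comment> \<open>This \<open>t\<close> solves
    \<open>exp (- (n * t\<^sup>2 / (2 * p))) = \<rho>\<close>, and it is also the second term of the
    bound in \<open>mean\<close>.\<close>
  define t where "t = sqrt (2 * ln (1 / \<rho>) * p) / sqrt (real n)"
  have ln: "ln (1 / \<rho>) > 0" using \<rho> by simp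
  have t: "t \<ge> 0" unfolding t_def using ln p by simp
  have "real n * t\<^sup>2 / (2 * p) = ln (1 / \<rho>)"
    using ln p n by (simp add: t_def power_divide)
  then have "exp (- (real n * t\<^sup>2 / (2 * p))) = \<rho>"
    using \<rho> by (simp add: ln_div)
  then have "1 - \<rho> \<le> prob {\<omega> \<in> space M. m \<omega> < expectation m + t}"
    using signed_mean_concentration[OF U_indep p[unfolded p_def] t] by (simp add: m_def p_def)
  also have "\<dots> \<le> \<P>(\<omega> in M. test_stat n X Vu Vl \<epsilon> (\<lambda>i. Y i \<omega>) b > q)"
  proof (rule finite_measure_mono)
    show "{\<omega> \<in> space M. test_stat n X Vu Vl \<epsilon> (\<lambda>i. Y i \<omega>) b > q} \<in> events"
    proof (rule outcome_event)
      show "(q < test_stat n X Vu Vl \<epsilon> y b) = (q < test_stat n X Vu Vl \<epsilon> y' b)"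
        if "\<And>i. i \<in> {1..n} \<Longrightarrow> y i = y' i" for y y'
        by (simp only: test_stat_cong[of n y y', OF that])
    qed
    show "{\<omega> \<in> space M. m \<omega> < expectation m + t}
      \<subseteq> {\<omega> \<in> space M. test_stat n X Vu Vl \<epsilon> (\<lambda>i. Y i \<omega>) b > q}"
    proof safe
      fix \<omega> assume \<omega>: "\<omega> \<in> space M" and less: "m \<omega> < expectation m + t"
      \<comment> \<open>The mean lies below \<open>- c / sqrt n\<close> by the margin
        \<open>t\<close>, so an upward fluctuation smaller than \<open>t\<close> still leaves
        \<open>m\<close> strictly below that threshold.\<close>
      have "expectation m \<le> - (c / sqrt (real n)) - t"
        using mean by (simp add: m_def c_def t_def add_divide_distrib)
      with less have "m \<omega> < - (c / sqrt (real n))" by linarith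
      then have "c / sqrt (real n) < - m \<omega>" by linarith
      then have "c < - (sqrt (real n) * m \<omega>)"
        using n by (simp add: pos_divide_less_eq mult.commute)
      then have "q < sqrt (real n) * (- m \<omega> / max (sqrt (p - (m \<omega>)\<^sup>2)) \<epsilon>)"
        using studentized_gt[OF n_pos \<epsilon> q] p by (simp add: c_def)
      also have "\<dots> \<le> test_stat n X Vu Vl \<epsilon> (\<lambda>i. Y i \<omega>) b"
        by (rule lower) (use Y_binary \<omega> in \<open>auto simp: m_def\<close>)
      finally show "q < test_stat n X Vu Vl \<epsilon> (\<lambda>i. Y i \<omega>) b" .
    qed
  qed
  finally show ?thesis .
qed

end

text \<open>Positivity of the mean indicator excludes a degenerate case: were it zero, the moment
  would vanish and the inequality would only say \<open>q = 0\<close>, while the statistic may then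
  be identically 0 and never reject.\<close>

theorem theorem5:
  fixes M :: "'a measure" and n :: nat
    and X :: "nat \<Rightarrow> real ^ 'k" and Y U :: "nat \<Rightarrow> 'a \<Rightarrow> real"
    and B Vu Vl :: "(real ^ 'k) set" and b :: "real ^ 'k"
    and \<epsilon> \<alpha> \<rho> q :: real
  assumes model: "binary_choice M n X Y U B"
    and U_indep: "prob_space.indep_vars M (\<lambda>_. borel) U {1..n}"
    and nonempty: "Vu \<noteq> {}" "Vl \<noteq> {}"
    and \<epsilon>: "\<epsilon> > 0"
    and \<alpha>: "0 < \<alpha>" "\<alpha> < 1"
    and b: "b \<in> B"
    and \<rho>: "0 < \<rho>" "\<rho> < 1"
    and q_def: "q = crit_val M n X U Vu Vl \<epsilon> \<alpha> b"
    and violation: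
      "(\<exists>v\<in>Vu. En n (ind_u X b v) > 0 \<and>
          integral\<^sup>L M (\<lambda>\<omega>. m_u n X (\<lambda>i. Y i \<omega>) b v)
          \<le> - (1 / sqrt (real n)) *
              (q * max \<epsilon> (sqrt (En n (ind_u X b v) / (1 + q\<^sup>2 / real n)))
               + sqrt (2 * ln (1 / \<rho>) * En n (ind_u X b v))))
       \<or> (\<exists>v\<in>Vl. En n (ind_l X b v) > 0 \<and>
          integral\<^sup>L M (\<lambda>\<omega>. m_l n X (\<lambda>i. Y i \<omega>) b v)
          \<le> - (1 / sqrt (real n)) *
              (q * max \<epsilon> (sqrt (En n (ind_l X b v) / (1 + q\<^sup>2 / real n)))
               + sqrt (2 * ln (1 / \<rho>) * En n (ind_l X b v))))"
  shows "\<P>(\<omega> in M. test_stat n X Vu Vl \<epsilon> (\<lambda>i. Y i \<omega>) b > q) \<ge> 1 - \<rho>"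
proof -
  interpret binary_choice M n X Y U B by (rule model)
  have q: "q \<ge> 0"
    unfolding q_def using prob_space_axioms n_pos \<epsilon> nonempty \<alpha> by (rule crit_val_nonneg)
  \<comment> \<open>Squaring fixes an indicator and removes the sign of \<open>- ind_l\<close>, so
    the mean squared weight is the mean indicator on both sides.\<close>
  have sq_u: "(\<lambda>i. (ind_u X b v i)\<^sup>2) = ind_u X b v" for v
    by (auto simp: ind_u_def)
  have sq_l: "(\<lambda>i. (- ind_l X b v i)\<^sup>2) = ind_l X b v" for v
    by (auto simp: ind_l_def)
  from violation show ?thesis
  proof (elim disjE bexE conjE)
    fix v assume v: "v \<in> Vu" and p: "En n (ind_u X b v) > 0"
      and mean: "integral\<^sup>L M (\<lambda>\<omega>. m_u n X (\<lambda>i. Y i \<omega>) b v)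
          \<le> - (1 / sqrt (real n)) *
              (q * max \<epsilon> (sqrt (En n (ind_u X b v) / (1 + q\<^sup>2 / real n)))
               + sqrt (2 * ln (1 / \<rho>) * En n (ind_u X b v)))"
    show ?thesis
    proof (rule prob_test_stat_gt[OF U_indep \<epsilon> \<rho> q _ p mean[unfolded m_u_eq_signed_mean]])
      show "En n (ind_u X b v) = En n (\<lambda>i. (ind_u X b v i)\<^sup>2)"
        by (simp only: sq_u)
      show "sqrt (real n) * (- m / max (sqrt (En n (ind_u X b v) - m\<^sup>2)) \<epsilon>) \<le> test_stat n X Vu Vl \<epsilon> y b"
        if "\<And>i. i \<in> {1..n} \<Longrightarrow> y i \<in> {0, 1}" "m = signed_mean n y (ind_u X b v)" for y m
        using studentized_u_le_test_stat[OF n_pos \<epsilon> that(1) v]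
        by (simp add: that(2) sigma_u_def m_u_eq_signed_mean)
    qed
  next
    fix v assume v: "v \<in> Vl" and p: "En n (ind_l X b v) > 0"
      and mean: "integral\<^sup>L M (\<lambda>\<omega>. m_l n X (\<lambda>i. Y i \<omega>) b v)
          \<le> - (1 / sqrt (real n)) *
              (q * max \<epsilon> (sqrt (En n (ind_l X b v) / (1 + q\<^sup>2 / real n)))
               + sqrt (2 * ln (1 / \<rho>) * En n (ind_l X b v)))"
    show ?thesis
    proof (rule prob_test_stat_gt[OF U_indep \<epsilon> \<rho> q _ p mean[unfolded m_l_eq_signed_mean]])
      show "En n (ind_l X b v) = En n (\<lambda>i. (- ind_l X b v i)\<^sup>2)"
        by (simp only: sq_l)
      show "sqrt (real n) * (- m / max (sqrt (En n (ind_l X b v) - m\<^sup>2)) \<epsilon>) \<le> test_stat n X Vu Vl \<epsilon> y b"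
        if "\<And>i. i \<in> {1..n} \<Longrightarrow> y i \<in> {0, 1}" "m = signed_mean n y (\<lambda>i. - ind_l X b v i)" for y m
        using studentized_l_le_test_stat[OF n_pos \<epsilon> that(1) v]
        by (simp add: that(2) sigma_l_def m_l_eq_signed_mean)
    qed
  qed
qed

end
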